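(* $H<H^+$.
   Context: A ceer is an equivalence relation on $\mathbb N$ c.e. as a subset of $\mathbb N^2$; $R_1\leq R_2$ means there is a total computable $f$ with $xR_1y\Leftrightarrow f(x)R_2f(y)$; $R_1<R_2$ means $R_1\leq R_2$ and $R_2\not\leq R_1$. With $\varphi_e$ the standard enumeration of partial computable functions, the halting equivalence $H$ is $xHy\Leftrightarrow x=y\lor\varphi_x(x)\!\downarrow\,=\varphi_y(y)\!\downarrow$. The saturation jump $E^+$ of a ceer $E$ is the equivalence relation on the set $[\mathbb N]^{<\omega}$ of finite subsets of $\mathbb N$ (identified with $\mathbb N$ via a fixed computable bijection) given by $xE^+y\Leftrightarrow [x]_E=[y]_E$, where $[X]_E=\{y:\exists x\in X\,(xEy)\}$. *)

theory Defs
  imports Main "HOL-Library.Nat_Bijection"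
begin

text \<open>
  Kleene's schemes for the partial recursive functions, in one-argument form: several arguments are
  passed as one number through the Cantor pairing \<^const>\<open>prod_encode\<close>, with the two projections and
  the pairing of functions among the schemes.
\<close>

datatype prog =
    Zero
  | Succ
  | Left
  | Right
  | Pair prog prog
  | Comp prog prog
  | PrimRec prog prog
  | Mu prog

text \<open>
  \<^const>\<open>None\<close> means divergence. In \<open>PrimRec f g\<close> and \<open>Mu f\<close> the input is read as
  \<open>(a, n)\<close> and \<open>a\<close> respectively, where \<open>a\<close> is the parameter; minimization requires all values below
  the zero that is found to be defined.
\<close>

primrec run :: "prog \<Rightarrow> nat \<Rightarrow> nat option" where
  "run Zero x = Some 0"
| "run Succ x = Some (Suc x)"
| "run Left x = Some (fst (prod_decode x))"
| "run Right x = Some (snd (prod_decode x))"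
| "run (Pair f g) x =
     Option.bind (run f x) (\<lambda>u. Option.bind (run g x) (\<lambda>v. Some (prod_encode (u, v))))"
| "run (Comp f g) x = Option.bind (run g x) (run f)"
| "run (PrimRec f g) x =
     (let (a, n) = prod_decode x in
      rec_nat (run f a)
        (\<lambda>k r. Option.bind r (\<lambda>v. run g (prod_encode (a, prod_encode (k, v))))) n)"
| "run (Mu f) x =
     (let is_min = (\<lambda>n. run f (prod_encode (x, n)) = Some 0 \<and>
                        (\<forall>m<n. \<exists>v. run f (prod_encode (x, m)) = Some (Suc v)))
      in if \<exists>n. is_min n then Some (THE n. is_min n) else None)"

primrec prog_encode :: "prog \<Rightarrow> nat" where
  "prog_encode Zero = 0"
| "prog_encode Succ = 1"
| "prog_encode Left = 2"
| "prog_encode Right = 3"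
| "prog_encode (Pair f g) = 4 + 4 * prod_encode (prog_encode f, prog_encode g)"
| "prog_encode (Comp f g) = 5 + 4 * prod_encode (prog_encode f, prog_encode g)"
| "prog_encode (PrimRec f g) = 6 + 4 * prod_encode (prog_encode f, prog_encode g)"
| "prog_encode (Mu f) = 7 + 4 * prog_encode f"

lemma prog_encode_inject: "prog_encode p = prog_encode q \<Longrightarrow> p = q"
proof (induction p arbitrary: q)
  case Zero then show ?case by (cases q) auto
next
  case Succ then show ?case by (cases q) auto
next
  case Left then show ?case by (cases q) auto
next
  case Right then show ?case by (cases q) auto
next
  case (Pair f g) then show ?case by (cases q; simp; presburger)
next
  case (Comp f g) then show ?case by (cases q; simp; presburger)
next
  case (PrimRec f g) then show ?case by (cases q; simp; presburger)
next
  case (Mu f) then show ?case by (cases q; simp; presburger)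
qed

lemma prog_encode_surj: "\<exists>p. prog_encode p = e"
proof (induction e rule: less_induct)
  case (less e)
  show ?case
  proof (cases "e < 4")
    case True
    then have "e = 0 \<or> e = 1 \<or> e = 2 \<or> e = 3" by auto
    then show ?thesis using prog_encode.simps(1-4) by metis
  next
    case False
    define n where "n = (e - 4) div 4"
    obtain a b where ab: "n = prod_encode (a, b)"
      by (metis prod_decode_inverse surj_pair)
    have "n < e" using False by (simp add: n_def)
    moreover have "a \<le> n" "b \<le> n"
      by (simp_all add: ab le_prod_encode_1 le_prod_encode_2)
    ultimately obtain p q r
      where "prog_encode p = n" "prog_encode q = a" "prog_encode r = b"
      using less by (meson le_less_trans)
    moreover have "e = 4 + 4 * n \<or> e = 5 + 4 * n \<or> e = 6 + 4 * n \<or> e = 7 + 4 * n"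
      using False unfolding n_def by presburger
    ultimately show ?thesis
      using prog_encode.simps(5-8) ab by metis
  qed
qed

lemma bij_prog_encode: "bij prog_encode"
  by (auto simp: bij_def inj_def surj_def intro: prog_encode_inject)
     (metis prog_encode_surj)

definition phi :: "nat \<Rightarrow> nat \<Rightarrow> nat option" where
  "phi e = run (inv prog_encode e)"

lemma phi_prog_encode: "phi (prog_encode p) = run p"
  by (simp add: phi_def bij_is_inj[OF bij_prog_encode])

definition total_computable :: "(nat \<Rightarrow> nat) \<Rightarrow> bool" where
  "total_computable f \<longleftrightarrow> (\<exists>e. \<forall>x. phi e x = Some (f x))"

definition reducible :: "(nat \<Rightarrow> nat \<Rightarrow> bool) \<Rightarrow> (nat \<Rightarrow> nat \<Rightarrow> bool) \<Rightarrow> bool" where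
  "reducible R S \<longleftrightarrow> (\<exists>f. total_computable f \<and> (\<forall>x y. R x y \<longleftrightarrow> S (f x) (f y)))"

definition strictly_reducible :: "(nat \<Rightarrow> nat \<Rightarrow> bool) \<Rightarrow> (nat \<Rightarrow> nat \<Rightarrow> bool) \<Rightarrow> bool" where
  "strictly_reducible R S \<longleftrightarrow> reducible R S \<and> \<not> reducible S R"

definition halting_equiv :: "nat \<Rightarrow> nat \<Rightarrow> bool" where
  "halting_equiv x y \<longleftrightarrow> x = y \<or> (\<exists>v. phi x x = Some v \<and> phi y y = Some v)"

definition saturation :: "(nat \<Rightarrow> nat \<Rightarrow> bool) \<Rightarrow> nat set \<Rightarrow> nat set" where
  "saturation E X = {y. \<exists>x\<in>X. E x y}"

text \<open>
  Finite sets of natural numbers are identified with their canonical indices: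
  \<^const>\<open>set_decode\<close> sends \<open>n\<close> to the set of positions of the binary digit 1 in \<open>n\<close>,
  a bijection from the natural numbers onto the finite sets of natural numbers.
\<close>

definition saturation_jump :: "(nat \<Rightarrow> nat \<Rightarrow> bool) \<Rightarrow> nat \<Rightarrow> nat \<Rightarrow> bool" where
  "saturation_jump E m n \<longleftrightarrow> saturation E (set_decode m) = saturation E (set_decode n)"

end

theory Submission imports Defs begin

text \<open>
  If \<open>f\<close> reduces \<open>H\<^sup>+\<close> to \<open>H\<close> and \<open>f A\<close> is a non-halting index, then the \<open>H\<^sup>+\<close>-class of \<open>A\<close> is
  the preimage under \<open>f\<close> of a point, hence decidable. This is impossible when \<open>A\<close> contains a halting
  index \<open>k\<close>, because then the saturation of \<open>A\<close> is undecidable. So \<open>f {k, x}\<close> is a halting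
  index for every \<open>x\<close>, and evaluating it with an interpreter turns \<open>f\<close> into a reduction to equality,
  which decides the class of \<open>k\<close>; again a contradiction.
\<close>

section \<open>Total computable functions\<close>

abbreviation pi1 :: "nat \<Rightarrow> nat" where "pi1 z \<equiv> fst (prod_decode z)"
abbreviation pi2 :: "nat \<Rightarrow> nat" where "pi2 z \<equiv> snd (prod_decode z)"

lemma phi_eq_run: "\<exists>p. phi e = run p"
  unfolding phi_def by blast

lemma total_computable_iff: "total_computable f \<longleftrightarrow> (\<exists>p. \<forall>x. run p x = Some (f x))"
  unfolding total_computable_def by (metis phi_eq_run phi_prog_encode)

lemma total_computableI: "(\<And>x. run p x = Some (f x)) \<Longrightarrow> total_computable f"
  by (auto simp: total_computable_iff)

lemma tc_comp:
  assumes "total_computable f" "total_computable g"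
  shows "total_computable (\<lambda>x. f (g x))"
proof -
  obtain p q where "\<And>x. run p x = Some (f x)" "\<And>x. run q x = Some (g x)"
    using assms unfolding total_computable_iff by blast
  then show ?thesis by (intro total_computableI[of "Comp p q"]) simp
qed

lemma tc_pair:
  assumes "total_computable f" "total_computable g"
  shows "total_computable (\<lambda>x. prod_encode (f x, g x))"
proof -
  obtain p q where "\<And>x. run p x = Some (f x)" "\<And>x. run q x = Some (g x)"
    using assms unfolding total_computable_iff by blast
  then show ?thesis by (intro total_computableI[of "Pair p q"]) simp
qed

lemma tc_Suc: "total_computable f \<Longrightarrow> total_computable (\<lambda>x. Suc (f x))"
  by (rule tc_comp[of Suc], rule total_computableI[of Succ]) simp

lemma tc_fst: "total_computable f \<Longrightarrow> total_computable (\<lambda>x. pi1 (f x))"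
  by (rule tc_comp[of pi1], rule total_computableI[of Left]) simp

lemma tc_snd: "total_computable f \<Longrightarrow> total_computable (\<lambda>x. pi2 (f x))"
  by (rule tc_comp[of pi2], rule total_computableI[of Right]) simp

lemma tc_id: "total_computable (\<lambda>x. x)"
  by (rule total_computableI[of "Pair Left Right"]) simp

lemma tc_const: "total_computable (\<lambda>x. c)"
proof (induction c)
  case 0
  then show ?case by (intro total_computableI[of Zero]) simp
qed (rule tc_Suc)

text \<open>\<open>PrimRec\<close> takes parameter and counter as one pair, so it is composed with a
  program computing \<open>(x, n x)\<close>. The step function has to be computable on codes of
  triples.\<close>

lemma tc_rec:
  assumes "total_computable f"
    and "total_computable (\<lambda>z. g (pi1 z) (pi1 (pi2 z)) (pi2 (pi2 z)))"
    and "total_computable n"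
  shows "total_computable (\<lambda>x. rec_nat (f x) (\<lambda>k v. g x k v) (n x))"
proof -
  let ?g = "\<lambda>z. g (pi1 z) (pi1 (pi2 z)) (pi2 (pi2 z))"
  obtain p where p: "\<And>x. run p x = Some (f x)" using assms(1) unfolding total_computable_iff by blast
  obtain q where q: "\<And>x. run q x = Some (?g x)" using assms(2) unfolding total_computable_iff by blast
  have "run (PrimRec p q) (prod_encode (x, m)) = Some (rec_nat (f x) (\<lambda>k v. g x k v) m)" for x m
    by (induction m) (simp_all add: p q)
  moreover have "total_computable (\<lambda>x. prod_encode (x, n x))"
    by (intro tc_pair tc_id assms)
  then obtain r where "\<And>x. run r x = Some (prod_encode (x, n x))"
    unfolding total_computable_iff by blast
  ultimately show ?thesis
    by (intro total_computableI[of "Comp (PrimRec p q) r"]) (simp del: run.simps(7))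
qed

lemmas tc_basic = tc_const tc_id tc_Suc tc_fst tc_snd tc_pair

section \<open>Arithmetic and definition by cases\<close>

lemma tc_pred:
  assumes "total_computable f"
  shows "total_computable (\<lambda>x. f x - 1)"
proof -
  have "total_computable (\<lambda>x. rec_nat 0 (\<lambda>k v. k) (f x))"
    by (intro tc_rec tc_basic assms)
  moreover have "rec_nat 0 (\<lambda>k v. k) n = n - 1" for n :: nat by (cases n) auto
  ultimately show ?thesis by simp
qed

lemma tc_add:
  assumes "total_computable f" "total_computable g"
  shows "total_computable (\<lambda>x. f x + g x)"
proof -
  have "total_computable (\<lambda>x. rec_nat (f x) (\<lambda>k v. Suc v) (g x))"
    by (intro tc_rec tc_basic assms)
  moreover have "rec_nat m (\<lambda>k v. Suc v) n = m + n" for m n :: nat by (induction n) auto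
  ultimately show ?thesis by simp
qed

lemma tc_diff:
  assumes "total_computable f" "total_computable g"
  shows "total_computable (\<lambda>x. f x - g x)"
proof -
  have "total_computable (\<lambda>x. rec_nat (f x) (\<lambda>k v. v - 1) (g x))"
    by (intro tc_rec tc_pred tc_basic assms)
  moreover have "rec_nat m (\<lambda>k v. v - 1) n = m - n" for m n :: nat by (induction n) auto
  ultimately show ?thesis by simp
qed

lemma tc_power2:
  assumes "total_computable f"
  shows "total_computable (\<lambda>x. 2 ^ f x)"
proof -
  have "total_computable (\<lambda>x. rec_nat 1 (\<lambda>k v. v + v) (f x))"
    by (intro tc_rec tc_add tc_basic assms)
  moreover have "rec_nat 1 (\<lambda>k v. v + v) n = (2::nat) ^ n" for n :: nat by (induction n) auto
  ultimately show ?thesis by simp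
qed

text \<open>The two truncated differences sum to 0 exactly when the tested values agree; otherwise
  the recursion makes at least one step, which discards everything but \<open>g x\<close>.\<close>

lemma tc_if_eq:
  assumes "total_computable a" "total_computable b" "total_computable f" "total_computable g"
  shows "total_computable (\<lambda>x. if a x = b x then f x else g x)"
proof -
  have "total_computable (\<lambda>x. rec_nat (f x) (\<lambda>k v. g x) ((a x - b x) + (b x - a x)))"
    by (intro tc_rec tc_add tc_diff tc_comp[OF assms(4)] tc_basic assms)
  moreover have "rec_nat u (\<lambda>k v. w) ((m - n) + (n - m)) = (if m = n then u else w)"
    for u w m n :: nat
    by (cases "(m - n) + (n - m)") auto
  ultimately show ?thesis by simp
qed

lemma tc_mod4:
  assumes "total_computable f"
  shows "total_computable (\<lambda>x. f x mod 4)"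
proof -
  have "total_computable (\<lambda>x. rec_nat 0 (\<lambda>k v. if v = 3 then 0 else Suc v) (f x))"
    by (intro tc_rec tc_if_eq tc_basic assms)
  moreover have "rec_nat 0 (\<lambda>k v. if v = 3 then 0 else Suc v) n = n mod 4" for n :: nat
    by (induction n) (auto simp: mod_Suc)
  ultimately show ?thesis by simp
qed

lemma tc_div4:
  assumes "total_computable f"
  shows "total_computable (\<lambda>x. f x div 4)"
proof -
  have "total_computable (\<lambda>x. rec_nat 0 (\<lambda>k v. if k mod 4 = 3 then Suc v else v) (f x))"
    by (intro tc_rec tc_if_eq tc_mod4 tc_basic assms)
  moreover have "rec_nat 0 (\<lambda>k v. if k mod 4 = 3 then Suc v else v) n = n div 4" for n :: nat
    by (induction n) (auto simp: div_Suc mod_Suc)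
  ultimately show ?thesis by simp
qed

lemmas tc_intros = tc_basic tc_pred tc_add tc_diff tc_power2 tc_if_eq tc_mod4 tc_div4

lemma tc_if_mem:
  assumes "finite A" "total_computable f" "total_computable g"
  shows "total_computable (\<lambda>x. if x \<in> A then f x else g x)"
  using assms(1)
proof induction
  case empty
  then show ?case using assms by simp
next
  case (insert a A)
  then have "total_computable (\<lambda>x. if x = a then f x else if x \<in> A then f x else g x)"
    by (intro tc_intros assms)
  moreover have "(\<lambda>x. if x = a then f x else if x \<in> A then f x else g x) =
      (\<lambda>x. if x \<in> insert a A then f x else g x)"
    by auto
  ultimately show ?case by (simp only:)
qed

text \<open>A new element \<open>y\<close> adds \<open>2 ^ y\<close> to the canonical index, and
  membership in a fixed finite set is a finite list of equality tests.\<close>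

lemma tc_insert:
  assumes "finite A"
  shows "total_computable (\<lambda>y. set_encode (insert y A))"
proof -
  have "total_computable (\<lambda>y. if y \<in> A then set_encode A else 2 ^ y + set_encode A)"
    by (intro tc_if_mem tc_intros assms)
  moreover have "set_encode (insert y A) = (if y \<in> A then set_encode A else 2 ^ y + set_encode A)"
    for y
    using assms by (simp add: insert_absorb)
  ultimately show ?thesis by simp
qed

lemma run_Mu_total:
  assumes p: "\<And>n. run p (prod_encode (x, n)) = Some (f n)" and "f m = 0"
  obtains n where "run (Mu p) x = Some n" "f n = 0"
proof -
  define n where "n = (LEAST n. f n = 0)"
  have n: "f n = 0" unfolding n_def using assms(2) by (rule LeastI)
  have less: "f i > 0" if "i < n" for i using that not_less_Least unfolding n_def by blast
  let ?P = "\<lambda>n. run p (prod_encode (x, n)) = Some 0 \<and>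
                (\<forall>m<n. \<exists>v. run p (prod_encode (x, m)) = Some (Suc v))"
  have 1: "?P n" using n less by (auto simp: p gr0_conv_Suc)
  have "(THE n. ?P n) = n"
  proof (rule the_equality[of ?P, OF 1])
    fix i assume "?P i"
    then show "i = n" using 1 by (metis linorder_neqE_nat option.inject nat.distinct(1))
  qed
  then have "run (Mu p) x = Some n" using 1 by (auto simp: Let_def)
  then show thesis using n that by blast
qed


section \<open>An interpreter\<close>

text \<open>
  A stack machine on numbers. The state \<open>eval_state c x K\<close> is about to run the program with code
  \<open>c\<close> on \<open>x\<close>, and \<open>ret_state v K\<close> returns \<open>v\<close> to the stack \<open>K\<close>, where \<open>0\<close> is the empty stack.
  A frame is a tag together with what is needed to resume: 0 and 1 stand for \<^const>\<open>Pair\<close> waiting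
  for its first and second component, 2, 3 and 4 for \<^const>\<open>Comp\<close>, \<^const>\<open>PrimRec\<close> and \<^const>\<open>Mu\<close>.
\<close>

definition eval_state :: "nat \<Rightarrow> nat \<Rightarrow> nat \<Rightarrow> nat" where
  "eval_state c x K = prod_encode (Suc c, prod_encode (x, K))"

definition ret_state :: "nat \<Rightarrow> nat \<Rightarrow> nat" where
  "ret_state v K = prod_encode (0, prod_encode (v, K))"

text \<open>\<open>Suc\<close> keeps every nonempty stack apart from \<open>0\<close>.\<close>

definition push :: "nat \<Rightarrow> nat \<Rightarrow> nat \<Rightarrow> nat" where
  "push t d K = Suc (prod_encode (prod_encode (t, d), K))"

text \<open>By the definition of \<^const>\<open>prog_encode\<close>, \<open>c mod 4\<close> is the constructor within the group of
  atomic programs (\<open>c div 4 = 0\<close>) or of compound ones, with arguments coded by \<open>c div 4 - 1\<close>.\<close>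

definition eval_step :: "nat \<Rightarrow> nat \<Rightarrow> nat \<Rightarrow> nat" where
  "eval_step c x K =
     (if c div 4 = 0 then
        if c mod 4 = 0 then ret_state 0 K
        else if c mod 4 = 1 then ret_state (Suc x) K
        else if c mod 4 = 2 then ret_state (pi1 x) K
        else ret_state (pi2 x) K
      else if c mod 4 = 0 then
        eval_state (pi1 (c div 4 - 1)) x (push 0 (prod_encode (pi2 (c div 4 - 1), x)) K)
      else if c mod 4 = 1 then
        eval_state (pi2 (c div 4 - 1)) x (push 2 (pi1 (c div 4 - 1)) K)
      else if c mod 4 = 2 then
        if pi2 x = 0 then eval_state (pi1 (c div 4 - 1)) (pi1 x) K
        else eval_state c (prod_encode (pi1 x, pi2 x - 1))
          (push 3 (prod_encode (pi2 (c div 4 - 1), prod_encode (pi1 x, pi2 x - 1))) K)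
      else eval_state (c div 4 - 1) (prod_encode (x, 0))
        (push 4 (prod_encode (c div 4 - 1, prod_encode (x, 0))) K))"

text \<open>Next to a program code, a frame with tag 3 carries parameter and counter, and one with
  tag 4 the argument and the current candidate of the search.\<close>

definition ret_step :: "nat \<Rightarrow> nat \<Rightarrow> nat \<Rightarrow> nat \<Rightarrow> nat" where
  "ret_step v t d K =
     (if t = 0 then eval_state (pi1 d) (pi2 d) (push 1 v K)
      else if t = 1 then ret_state (prod_encode (d, v)) K
      else if t = 2 then eval_state d v K
      else if t = 3 then
        eval_state (pi1 d) (prod_encode (pi1 (pi2 d), prod_encode (pi2 (pi2 d), v))) K
      else if v = 0 then ret_state (pi2 (pi2 d)) K
      else eval_state (pi1 d) (prod_encode (pi1 (pi2 d), Suc (pi2 (pi2 d))))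
        (push 4 (prod_encode (pi1 d, prod_encode (pi1 (pi2 d), Suc (pi2 (pi2 d))))) K))"

definition step :: "nat \<Rightarrow> nat" where
  "step s =
     (if pi1 s = 0 then
        if pi2 (pi2 s) = 0 then s
        else ret_step (pi1 (pi2 s)) (pi1 (pi1 (pi2 (pi2 s) - 1))) (pi2 (pi1 (pi2 (pi2 s) - 1)))
          (pi2 (pi2 (pi2 s) - 1))
      else eval_step (pi1 s - 1) (pi1 (pi2 s)) (pi2 (pi2 s)))"

section \<open>Runs of the machine\<close>

lemma step_eval: "step (eval_state c x K) = eval_step c x K"
  by (simp add: step_def eval_state_def)

lemma step_push: "step (ret_state v (push t d K)) = ret_step v t d K"
  by (simp add: step_def ret_state_def push_def)

lemma step_halted: "step (ret_state v 0) = ret_state v 0"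
  by (simp add: step_def ret_state_def)

lemma tc_step: "total_computable step"
proof -
  have "total_computable (\<lambda>s. step s)"
    unfolding step_def eval_step_def ret_step_def eval_state_def ret_state_def push_def
    by (intro tc_intros)
  then show ?thesis by simp
qed

definition reaches :: "nat \<Rightarrow> nat \<Rightarrow> bool" where
  "reaches s t \<longleftrightarrow> (\<exists>n. (step ^^ n) s = t)"

lemma reaches_trans [trans]: "reaches s t \<Longrightarrow> reaches t u \<Longrightarrow> reaches s u"
  unfolding reaches_def by (metis funpow_add o_apply add.commute)

lemma reaches_step: "step s = t \<Longrightarrow> reaches s t"
  unfolding reaches_def by (rule exI[of _ 1]) simp

lemma mod4_simps [simp]:
  "(4 + 4 * n) mod 4 = (0::nat)" "(5 + 4 * n) mod 4 = (1::nat)"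
  "(6 + 4 * n) mod 4 = (2::nat)" "(7 + 4 * n) mod 4 = (3::nat)"
  "(4 + 4 * n) div 4 = Suc n" "(5 + 4 * n) div 4 = Suc n"
  "(6 + 4 * n) div 4 = Suc n" "(7 + 4 * n) div 4 = Suc n" for n :: nat
  by presburger+

text \<open>Only the halting direction is needed: the interpreter is run on halting indices alone.\<close>

lemma run_reaches:
  "run p x = Some v \<Longrightarrow> reaches (eval_state (prog_encode p) x K) (ret_state v K)"
\<comment> \<open>The stack stays arbitrary because subprograms run on top of pushed frames.\<close>
proof (induction p arbitrary: x v K)
  case Zero
  then show ?case by (intro reaches_step) (simp add: step_eval eval_step_def)
next
  case Succ
  then show ?case by (intro reaches_step) (simp add: step_eval eval_step_def)
next
  case Left
  then show ?case by (intro reaches_step) (simp add: step_eval eval_step_def)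
next
  case Right
  then show ?case by (intro reaches_step) (simp add: step_eval eval_step_def)
next
  case (Pair f g)
  then obtain a b where ab: "run f x = Some a" "run g x = Some b" "v = prod_encode (a, b)"
    by (auto simp: bind_eq_Some_conv)
  let ?d = "prod_encode (prog_encode g, x)"
  have "reaches (eval_state (prog_encode (Pair f g)) x K)
      (eval_state (prog_encode f) x (push 0 ?d K))"
    by (intro reaches_step) (simp add: step_eval eval_step_def)
  also have "reaches \<dots> (ret_state a (push 0 ?d K))"
    by (rule Pair.IH(1)[OF ab(1)])
  also have "reaches \<dots> (eval_state (prog_encode g) x (push 1 a K))"
    by (intro reaches_step) (simp add: step_push ret_step_def)
  also have "reaches \<dots> (ret_state b (push 1 a K))"
    by (rule Pair.IH(2)[OF ab(2)])
  also have "reaches \<dots> (ret_state v K)"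
    by (intro reaches_step) (simp add: step_push ret_step_def ab)
  finally show ?case .
next
  case (Comp f g)
  then obtain a where a: "run g x = Some a" "run f a = Some v"
    by (auto simp: bind_eq_Some_conv)
  have "reaches (eval_state (prog_encode (Comp f g)) x K)
      (eval_state (prog_encode g) x (push 2 (prog_encode f) K))"
    by (intro reaches_step) (simp add: step_eval eval_step_def)
  also have "reaches \<dots> (ret_state a (push 2 (prog_encode f) K))"
    by (rule Comp.IH(2)[OF a(1)])
  also have "reaches \<dots> (eval_state (prog_encode f) a K)"
    by (intro reaches_step) (simp add: step_push ret_step_def)
  also have "reaches \<dots> (ret_state v K)"
    by (rule Comp.IH(1)[OF a(2)])
  finally show ?case .
next
  case (PrimRec f g)
  \<comment> \<open>The machine counts down to 0, leaving one frame for each stage still to be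
    computed; hence an inner induction on the counter.\<close>
  have "reaches (eval_state (prog_encode (PrimRec f g)) (prod_encode (a, n)) K) (ret_state v K)"
    if "run (PrimRec f g) (prod_encode (a, n)) = Some v" for a n v K
    using that
  proof (induction n arbitrary: v K)
    case 0
    have "reaches (eval_state (prog_encode (PrimRec f g)) (prod_encode (a, 0)) K)
        (eval_state (prog_encode f) a K)"
      by (intro reaches_step) (simp add: step_eval eval_step_def)
    also have "reaches \<dots> (ret_state v K)"
      using 0 by (intro PrimRec.IH(1)) simp
    finally show ?case .
  next
    case (Suc n)
    then obtain w where w: "run (PrimRec f g) (prod_encode (a, n)) = Some w"
      "run g (prod_encode (a, prod_encode (n, w))) = Some v"
      by (auto simp: bind_eq_Some_conv)
    let ?d = "prod_encode (prog_encode g, prod_encode (a, n))"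
    have "reaches (eval_state (prog_encode (PrimRec f g)) (prod_encode (a, Suc n)) K)
        (eval_state (prog_encode (PrimRec f g)) (prod_encode (a, n)) (push 3 ?d K))"
      by (intro reaches_step) (simp add: step_eval eval_step_def)
    also have "reaches \<dots> (ret_state w (push 3 ?d K))"
      by (rule Suc.IH[OF w(1)])
    also have "reaches \<dots> (eval_state (prog_encode g) (prod_encode (a, prod_encode (n, w))) K)"
      by (intro reaches_step) (simp add: step_push ret_step_def)
    also have "reaches \<dots> (ret_state v K)"
      by (rule PrimRec.IH(2)[OF w(2)])
    finally show ?case .
  qed
  from this[of "pi1 x" "pi2 x"] PrimRec.prems show ?case by simp
next
  case (Mu f)
  let ?P = "\<lambda>n. run f (prod_encode (x, n)) = Some 0 \<and>
                (\<forall>m<n. \<exists>v. run f (prod_encode (x, m)) = Some (Suc v))"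
  let ?s = "\<lambda>n. eval_state (prog_encode f) (prod_encode (x, n))
    (push 4 (prod_encode (prog_encode f, prod_encode (x, n))) K)"
  have ex: "\<exists>n. ?P n" and v: "v = (THE n. ?P n)"
    using Mu.prems by (auto simp: Let_def split: if_splits)
  then obtain n where n: "?P n" by blast
  have "v = n" unfolding v
  proof (rule the_equality[of ?P, OF n])
    fix i assume "?P i"
    then show "i = n" using n by (metis linorder_neqE_nat option.inject nat.distinct(1))
  qed
  with n have Pv: "?P v" by simp
  \<comment> \<open>Induction downwards from \<open>v\<close>: each smaller candidate gives a
    nonzero value and passes the search on to the next one.\<close>
  have "reaches (?s j) (ret_state v K)" if "j \<le> v" for j
    using that
  proof (induction rule: inc_induct)
    case base
    have "reaches (?s v)
        (ret_state 0 (push 4 (prod_encode (prog_encode f, prod_encode (x, v))) K))"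
      using Pv by (intro Mu.IH) simp
    also have "reaches \<dots> (ret_state v K)"
      by (intro reaches_step) (simp add: step_push ret_step_def)
    finally show ?case .
  next
    case (step j)
    then obtain w where w: "run f (prod_encode (x, j)) = Some (Suc w)" using Pv by blast
    have "reaches (?s j)
        (ret_state (Suc w) (push 4 (prod_encode (prog_encode f, prod_encode (x, j))) K))"
      by (rule Mu.IH[OF w])
    also have "reaches \<dots> (?s (Suc j))"
      by (intro reaches_step) (simp add: step_push ret_step_def)
    also note step.IH
    finally show ?case .
  qed
  from this[of 0] have "reaches (?s 0) (ret_state v K)" by simp
  moreover have "reaches (eval_state (prog_encode (Mu f)) x K) (?s 0)"
    by (intro reaches_step) (simp add: step_eval eval_step_def)
  ultimately show ?case using reaches_trans by blast
qed

text \<open>Final states are fixed points of \<open>step\<close>, so after \<open>m + n\<close>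
  steps both results are still present in the same state.\<close>

lemma halted_stable:
  assumes "(step ^^ m) s = ret_state v 0" "(step ^^ n) s = ret_state w 0"
  shows "v = w"
proof -
  have halted: "(step ^^ k) (ret_state u 0) = ret_state u 0" for k u
    by (induction k) (simp_all add: step_halted)
  have "(step ^^ (m + n)) s = ret_state w 0"
    using assms(2) halted by (simp add: funpow_add)
  moreover have "(step ^^ (n + m)) s = ret_state v 0"
    using assms(1) halted by (simp add: funpow_add)
  ultimately show ?thesis by (simp add: add.commute ret_state_def prod_encode_eq)
qed

text \<open>The state after \<open>n\<close> steps is primitive recursive in \<open>n\<close>, so
  minimization finds a final state, from which the value is read off.\<close>

lemma interpreter: "\<exists>u. \<forall>e v. phi e e = Some v \<longrightarrow> run u e = Some v"
proof -
  define state where "state e n = (step ^^ n) (eval_state e e 0)" for e n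
  have "state e n = rec_nat (eval_state e e 0) (\<lambda>k s. step s) n" for e n
    by (induction n) (simp_all add: state_def)
  moreover have "total_computable
      (\<lambda>z. rec_nat (eval_state (pi1 z) (pi1 z) 0) (\<lambda>k s. step s) (pi2 z))"
    unfolding eval_state_def by (intro tc_rec tc_comp[OF tc_step] tc_intros)
  ultimately have tc_state: "total_computable (\<lambda>z. state (pi1 z) (pi2 z))" by simp
  \<comment> \<open>Zero exactly at return states with empty stack.\<close>
  define running where "running s = (if pi1 s = 0 then pi2 (pi2 s) else 1)" for s
  have tc_running: "total_computable running"
  proof -
    have "total_computable (\<lambda>s. running s)" unfolding running_def by (intro tc_intros)
    then show ?thesis by simp
  qed
  obtain p where p: "\<And>z. run p z = Some (running (state (pi1 z) (pi2 z)))"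
    using tc_comp[OF tc_running tc_state] unfolding total_computable_iff by blast
  have "total_computable (\<lambda>z. pi1 (pi2 (state (pi1 z) (pi2 z))))"
    by (intro tc_fst tc_snd tc_state)
  then obtain q where q: "\<And>z. run q z = Some (pi1 (pi2 (state (pi1 z) (pi2 z))))"
    unfolding total_computable_iff by blast
  \<comment> \<open>\<open>Pair Left Right\<close> computes the identity, so \<open>q\<close>
    receives the input together with the step count found by \<open>Mu p\<close>.\<close>
  define u where "u = Comp q (Pair (Pair Left Right) (Mu p))"
  have "run u e = Some v" if v: "phi e e = Some v" for e v
  proof -
    obtain r where r: "e = prog_encode r" by (metis prog_encode_surj)
    then have "run r e = Some v" using v by (simp add: phi_prog_encode)
    then obtain m where m: "state e m = ret_state v 0"
      using run_reaches[of r e v 0] r by (auto simp: reaches_def state_def)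
    obtain n where n: "run (Mu p) e = Some n" "running (state e n) = 0"
    proof (rule run_Mu_total[of p e "\<lambda>n. running (state e n)" m])
      show "running (state e m) = 0" by (simp add: m running_def ret_state_def)
    qed (use p in auto)
    then have "state e n = ret_state (pi1 (pi2 (state e n))) 0"
      by (auto simp: running_def ret_state_def split: if_splits)
         (metis prod.collapse prod_decode_inverse)
    \<comment> \<open>The step count \<open>n\<close> found by minimization may differ from
      \<open>m\<close>.\<close>
    then have "pi1 (pi2 (state e n)) = v"
      using m halted_stable unfolding state_def by metis
    then show ?thesis by (simp add: u_def n q del: run.simps(8))
  qed
  then show ?thesis by blast
qed


section \<open>The halting equivalence\<close>

lemma halting_refl: "halting_equiv x x"
  by (simp add: halting_equiv_def)

lemma halting_trans: "halting_equiv x y \<Longrightarrow> halting_equiv y z \<Longrightarrow> halting_equiv x z"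
  by (auto simp: halting_equiv_def)

lemma halting_sym: "halting_equiv x y \<Longrightarrow> halting_equiv y x"
  by (auto simp: halting_equiv_def)

text \<open>Makes membership in a saturation a question about \<open>saturation_jump\<close>, to
  which a reduction can be applied.\<close>

lemma saturation_insert_eq_iff:
  "saturation halting_equiv (insert y A) = saturation halting_equiv A \<longleftrightarrow>
   y \<in> saturation halting_equiv A"
  unfolding saturation_def using halting_refl halting_trans by blast

lemma saturation_singleton_eq_iff:
  "saturation halting_equiv {x} = saturation halting_equiv {y} \<longleftrightarrow> halting_equiv x y"
  unfolding saturation_def using halting_refl halting_trans halting_sym by blast

text \<open>
  Given a decision procedure, a program can ask about its own argument and return a value that
  falsifies the answer when the argument is the program's own code.
\<close>

lemma saturation_undecidable:
  assumes "finite A" "k \<in> A" "phi k k = Some v" "total_computable d"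
  shows "\<not> (\<forall>y. d y = c \<longleftrightarrow> y \<in> saturation halting_equiv A)"
proof
  assume d: "\<forall>y. d y = c \<longleftrightarrow> y \<in> saturation halting_equiv A"
  have "finite ((\<lambda>a. the (phi a a)) ` A)" using assms(1) by simp
  \<comment> \<open>\<open>w\<close> differs from the value of every halting index in
    \<open>A\<close>; a divergent index merely excludes one further number.\<close>
  then obtain w where w: "w \<notin> (\<lambda>a. the (phi a a)) ` A"
    using ex_new_if_finite infinite_UNIV_nat by blast
  have "total_computable (\<lambda>y. if d y = c then w else v)"
    by (intro tc_intros assms)
  then obtain p where "\<And>y. run p y = Some (if d y = c then w else v)"
    unfolding total_computable_iff by blast
  then have p: "phi (prog_encode p) y = Some (if d y = c then w else v)" for y
    by (simp add: phi_prog_encode)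
  let ?e = "prog_encode p"
  show False
  proof (cases "d ?e = c")
    case True
    then obtain a where a: "a \<in> A" "halting_equiv a ?e" using d by (auto simp: saturation_def)
    \<comment> \<open>Either \<open>a\<close> is the code itself or it halts with the same
      value.\<close>
    then have "phi a a = Some w" using p[of ?e] True by (auto simp: halting_equiv_def)
    then show False using w a(1) by force
  next
    case False
    then have "halting_equiv k ?e" using p[of ?e] assms(3) by (simp add: halting_equiv_def)
    then show False using False d assms(2) by (auto simp: saturation_def)
  qed
qed

section \<open>Comparison of \<open>halting_equiv\<close> with its saturation jump\<close>

lemma reducible_saturation_jump: "reducible halting_equiv (saturation_jump halting_equiv)"
  unfolding reducible_def
proof (intro exI conjI allI)
  show "total_computable (\<lambda>x. set_encode {x})" using tc_insert[of "{}"] by simp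
  show "halting_equiv x y \<longleftrightarrow> saturation_jump halting_equiv (set_encode {x}) (set_encode {y})" for x y
    by (simp add: saturation_jump_def saturation_singleton_eq_iff del: set_encode_insert)
qed

lemma not_reducible_saturation_jump: "\<not> reducible (saturation_jump halting_equiv) halting_equiv"
proof
  assume "reducible (saturation_jump halting_equiv) halting_equiv"
  then obtain f where f: "total_computable f"
    and red: "\<And>x y. saturation_jump halting_equiv x y \<longleftrightarrow> halting_equiv (f x) (f y)"
    by (auto simp: reducible_def)
  obtain k v where k: "phi k k = Some v"
    using phi_prog_encode[of Zero] by (metis run.simps(1))
  have mem_iff: "y \<in> saturation halting_equiv A \<longleftrightarrow>
      halting_equiv (f (set_encode (insert y A))) (f (set_encode A))" if "finite A" for y A
    using that
    by (simp add: red[symmetric] saturation_jump_def saturation_insert_eq_iff)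
  have tc_f: "total_computable (\<lambda>y. f (set_encode (insert y A)))" if "finite A" for A
    by (intro tc_comp[OF f] tc_insert that)
  have halts: "\<exists>w. phi (f (set_encode A)) (f (set_encode A)) = Some w" if "finite A" "k \<in> A" for A
  proof (rule ccontr)
    assume "\<not> ?thesis"
    \<comment> \<open>The class of a divergent index is a singleton, so equivalence to
      \<open>f (set_encode A)\<close> becomes equality, which is decidable.\<close>
    then have "f (set_encode (insert y A)) = f (set_encode A) \<longleftrightarrow> y \<in> saturation halting_equiv A"
      for y
      using mem_iff[OF that(1), of y] by (auto simp: halting_equiv_def)
    then show False
      using saturation_undecidable[OF that k tc_f[OF that(1)]] by blast
  qed
  obtain u where u: "\<And>e w. phi e e = Some w \<Longrightarrow> run u e = Some w"
    using interpreter by blast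
  \<comment> \<open>Every index at which \<open>val\<close> is used below halts, so
    \<open>the\<close> never meets \<open>None\<close>.\<close>
  define val where "val e = the (run u e)" for e
  obtain p where p: "\<And>x. run p x = Some (f (set_encode (insert x {k})))"
    using tc_f[of "{k}", OF finite.insertI[OF finite.emptyI]] unfolding total_computable_iff by blast
  have val: "phi (f (set_encode (insert x {k}))) (f (set_encode (insert x {k}))) =
      Some (val (f (set_encode (insert x {k}))))" for x
    using halts[of "insert x {k}"] u by (auto simp: val_def)
  have tc_val: "total_computable (\<lambda>x. val (f (set_encode (insert x {k}))))"
    by (rule total_computableI[of "Comp u p"]) (simp add: p u[OF val])
  \<comment> \<open>Halting indices are equivalent exactly when their values agree, so the value at
    \<open>{k}\<close> can serve as the constant \<open>c\<close> of
    \<open>saturation_undecidable\<close>.\<close>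
  have "val (f (set_encode (insert x {k}))) = val (f (set_encode {k})) \<longleftrightarrow>
      x \<in> saturation halting_equiv {k}" for x
  proof -
    have "phi (f (set_encode {k})) (f (set_encode {k})) = Some (val (f (set_encode {k})))"
      using val[of k] by (simp only: insert_absorb2)
    then show ?thesis
      unfolding mem_iff[OF finite.insertI[OF finite.emptyI]] halting_equiv_def using val[of x] by (metis option.inject)
  qed
  then have "\<forall>x. val (f (set_encode (insert x {k}))) = val (f (set_encode {k})) \<longleftrightarrow>
      x \<in> saturation halting_equiv {k}"
    by blast
  then show False
    using saturation_undecidable[of "{k}", OF _ _ k tc_val] by blast
qed

theorem theorem7p7: "strictly_reducible halting_equiv (saturation_jump halting_equiv)"
  by (simp add: strictly_reducible_def reducible_saturation_jump not_reducible_saturation_jump)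

end
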